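(* Let $a,b\in C^1(\mathbb{R})$ be $1$-periodic functions with $a>0$ and $0<b<1$ on $\mathbb{R}$. For each $T>0$, let $d_T\in\mathbb{R}$ be the unique speed of the time periodic traveling wave connecting $0$ and $1$ for $$v_t=v_{xx}+a(t/T)\,v\,\big(v-b(t/T)\big)(1-v),\qquad t\in\mathbb{R},\ x\in\mathbb{R}.$$ Then $\lim_{T\to0^+}d_T=d_0$ and $\lim_{T\to+\infty}d_T=d_*$, where $$d_0=\sqrt{2\int_0^1a(s)\,ds}\left(\frac12-\frac{\int_0^1a(s)b(s)\,ds}{\int_0^1a(s)\,ds}\right),\qquad d_*=\int_0^1\sqrt{2a(s)}\left(\frac12-b(s)\right)ds .$$
   Context: Let $a,b\in C^1(\mathbb{R})$ be $1$-periodic functions with $a>0$ and $0<b<1$ on $\mathbb{R}$, and let $T>0$. A time periodic traveling wave connecting $0$ and $1$ for the equation $v_t=v_{xx}+a(t/T)\,v\,\big(v-b(t/T)\big)(1-v)$, $t\in\mathbb{R}$, $x\in\mathbb{R}$, is a solution of the form $v_T(t,x)=V_T(t,x-d_Tt)$, $t,x\in\mathbb{R}$, with $d_T\in\mathbb{R}$ a constant, $V_T(t,x)$ $T$-periodic in $t$, and $V_T(t,-\infty)=1$, $V_T(t,+\infty)=0$ uniformly in $t$. It is known that for each $T>0$ such a wave exists, is unique up to spatial shifts (in particular $d_T$ is unique), and $V_T$ is decreasing in $x$. *)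

theory Defs
  imports "HOL-Analysis.Analysis"
begin

text \<open>
  Classical (\<open>C\<close> one in time, two in space) entire solutions \<open>v t x\<close> of
  \<open>v_t = v_xx + f t v\<close>; \<open>vt\<close>, \<open>vx\<close>, \<open>vxx\<close> are the partial derivatives, jointly continuous in
  \<open>(t, x)\<close>. Joint continuity of \<open>v\<close> itself then follows.
\<close>

definition classical_solution ::
    "(real \<Rightarrow> real \<Rightarrow> real) \<Rightarrow> (real \<Rightarrow> real \<Rightarrow> real) \<Rightarrow> bool" where
  "classical_solution f v \<longleftrightarrow>
     (\<exists>vt vx vxx :: real \<Rightarrow> real \<Rightarrow> real.
        (\<forall>t x. ((\<lambda>s. v s x) has_real_derivative vt t x) (at t)) \<and>
        (\<forall>t x. ((\<lambda>y. v t y) has_real_derivative vx t x) (at x)) \<and>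
        (\<forall>t x. ((\<lambda>y. vx t y) has_real_derivative vxx t x) (at x)) \<and>
        continuous_on UNIV (\<lambda>(t, x). vt t x) \<and>
        continuous_on UNIV (\<lambda>(t, x). vx t x) \<and>
        continuous_on UNIV (\<lambda>(t, x). vxx t x) \<and>
        (\<forall>t x. vt t x = vxx t x + f t (v t x)))"

definition bistable_nonlinearity ::
    "(real \<Rightarrow> real) \<Rightarrow> (real \<Rightarrow> real) \<Rightarrow> real \<Rightarrow> real \<Rightarrow> real \<Rightarrow> real" where
  "bistable_nonlinearity a b T t u = a (t / T) * u * (u - b (t / T)) * (1 - u)"

definition periodic_traveling_wave ::
    "(real \<Rightarrow> real) \<Rightarrow> (real \<Rightarrow> real) \<Rightarrow> real \<Rightarrow> real \<Rightarrow> (real \<Rightarrow> real \<Rightarrow> real) \<Rightarrow> bool" where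
  "periodic_traveling_wave a b T c V \<longleftrightarrow>
     classical_solution (bistable_nonlinearity a b T) (\<lambda>t x. V t (x - c * t)) \<and>
     (\<forall>t x. V (t + T) x = V t x) \<and>
     uniform_limit UNIV (\<lambda>x t. V t x) (\<lambda>t. 1) at_bot \<and>
     uniform_limit UNIV (\<lambda>x t. V t x) (\<lambda>t. 0) at_top"

definition wave_speed ::
    "(real \<Rightarrow> real) \<Rightarrow> (real \<Rightarrow> real) \<Rightarrow> real \<Rightarrow> real \<Rightarrow> bool" where
  "wave_speed a b T c \<longleftrightarrow> (\<exists>V. periodic_traveling_wave a b T c V)"

end

theory Submission imports Defs begin

text \<open>
  Any strict supersolution bounded below by some \<open>\<delta> > 0\<close> that exceeds \<open>1\<close> far to the left and is
  below \<open>1 - \<delta>\<close> far to the right of a point moving with mean speed \<open>s\<close> forces \<open>c \<le> s\<close> for every wave speed \<open>c\<close>: otherwise the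
  wave would catch up with a shifted copy of it, and the equation fails at the first contact.
  With the logistic profile \<open>front\<close>, \<open>front (k (x - c t))\<close> for \<open>k = sqrt (a / 2)\<close> and
  \<open>c = sqrt (2 a) (1 / 2 - b)\<close> is the exact wave for constant \<open>a\<close>, \<open>b\<close>. Lifting it by \<open>\<epsilon>\<close> and
  replacing \<open>b\<close> by \<open>b - 3 \<epsilon>\<close> leaves a positive margin. For large \<open>T\<close> the margin absorbs the slow
  variation of \<open>k\<close>; for small \<open>T\<close> it absorbs the error of first-order averaging.
  Lower bounds follow from the symmetry \<open>v \<mapsto> 1 - v\<close>, \<open>x \<mapsto> - x\<close>, \<open>b \<mapsto> 1 - b\<close>, \<open>c \<mapsto> - c\<close>.
\<close>

section \<open>Preliminaries from calculus and periodicity\<close>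

text \<open>At the minimum the slope vanishes. If \<open>l\<close> were negative, the slope would be
  negative just to the right, and the mean value theorem would produce a value below the minimum.
  Existence of the second derivative at the single point \<open>x\<close> is enough for this
  argument.\<close>

lemma second_derivative_nonneg_at_min:
  fixes g g' :: "real \<Rightarrow> real"
  assumes g: "\<And>y. (g has_real_derivative g' y) (at y)"
    and g': "(g' has_real_derivative l) (at x)" and min: "\<And>y. g x \<le> g y"
  shows "0 \<le> l"
proof (rule ccontr)
  assume "\<not> 0 \<le> l"
  then obtain e where e: "e > 0" "\<And>h. 0 < h \<Longrightarrow> h < e \<Longrightarrow> g' (x + h) < g' x"
    using DERIV_neg_dec_right[OF g'] by auto
  have "g' x = 0"
    using DERIV_local_min[OF g zero_less_one] min by auto
  obtain z where z: "x < z" "z < x + e / 2" "g (x + e / 2) - g x = (x + e / 2 - x) * g' z"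
    using MVT2[of x "x + e / 2" g g'] g e by auto
  have "g' z < 0"
    using e(2)[of "z - x"] z \<open>g' x = 0\<close> \<open>e > 0\<close> by auto
  then have "(x + e / 2 - x) * g' z < 0"
    using \<open>e > 0\<close> by (intro mult_pos_neg) auto
  then show False
    using z(3) min[of "x + e / 2"] by linarith
qed

lemma second_derivative_nonpos_at_max:
  fixes g g' :: "real \<Rightarrow> real"
  assumes g: "\<And>y. (g has_real_derivative g' y) (at y)"
    and g': "(g' has_real_derivative l) (at x)" and max: "\<And>y. g y \<le> g x"
  shows "l \<le> 0"
  using second_derivative_nonneg_at_min[of "\<lambda>y. - g y" "\<lambda>y. - g' y" "- l" x]
    assms DERIV_minus by fastforce

text \<open>Classical solutions are specified through their partial derivatives, while the
  compactness arguments below need joint continuity of the solution itself. A continuous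
  \<open>x\<close> partial and an existing \<open>t\<close> partial give total differentiability.
  The rule for partials wants this continuity for an operator-valued map, hence
  \<open>blinfun_scaleR_left\<close>.\<close>

lemma continuous_on_of_partial_derivatives:
  fixes v vt vx :: "real \<Rightarrow> real \<Rightarrow> real"
  assumes t: "\<And>t x. ((\<lambda>s. v s x) has_real_derivative vt t x) (at t)"
    and x: "\<And>t x. ((\<lambda>y. v t y) has_real_derivative vx t x) (at x)"
    and cont: "continuous_on UNIV (\<lambda>(t, x). vx t x)"
  shows "continuous_on UNIV (\<lambda>(t, x). v t x)"
proof -
  have "((\<lambda>(t, x). v t x) has_derivative
      (\<lambda>(r, y). (*) (vt t0 x0) r + blinfun_apply (blinfun_scaleR_left (vx t0 x0)) y))
      (at (t0, x0) within UNIV \<times> UNIV)" for t0 x0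
  proof (rule has_derivative_partialsI)
    show "((\<lambda>s. v s x0) has_derivative (*) (vt t0 x0)) (at t0 within UNIV)"
      using t by (simp add: has_field_derivative_def)
    show "((\<lambda>y. v s y) has_derivative blinfun_apply (blinfun_scaleR_left (vx s y0)))
        (at y0 within UNIV)" for s y0
      using x[of s y0] by (simp add: has_field_derivative_def mult.commute[of _ "vx s y0"])
    have "continuous (at (t0, x0)) (\<lambda>p. (\<lambda>(t, x). vx t x) p)"
      using cont by (simp add: continuous_on_eq_continuous_at)
    from bounded_linear.continuous[OF bounded_linear_blinfun_scaleR_left this]
    show "continuous (at (t0, x0) within UNIV \<times> UNIV)
        (\<lambda>(t, x). blinfun_scaleR_left (vx t x))"
      by (simp add: split_beta')
  qed auto
  then have "isCont (\<lambda>(t, x). v t x) (t0, x0)" for t0 x0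
    by (auto dest: has_derivative_continuous)
  then show ?thesis
    by (auto simp: continuous_on_eq_continuous_at)
qed

lemma periodic_int_shift:
  fixes f :: "real \<Rightarrow> 'a"
  assumes per: "\<And>t. f (t + T) = f t"
  shows "f (t + of_int n * T) = f t"
proof -
  have nat: "f (t + of_nat k * T) = f t" for t k
  proof (induction k)
    case (Suc k)
    then show ?case
      using per[of "t + of_nat k * T"] by (simp add: algebra_simps)
  qed simp
  show ?thesis
  proof (cases n)
    case (nonneg k)
    then show ?thesis using nat by simp
  next
    case (neg k)
    then have "of_int n = - real (Suc k)"
      by simp
    then have "t + of_int n * T + of_nat (Suc k) * T = t"
      by (simp only: mult_minus_left)
    then show ?thesis
      using nat[of "t + of_int n * T" "Suc k"] by metis
  qed
qed

lemma periodic_representative: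
  fixes f :: "real \<Rightarrow> 'a" and t :: real
  assumes per: "\<And>t. f (t + T) = f t" and "0 < T"
  obtains s where "s \<in> {0..T}" "f s = f t"
proof
  show "t + of_int (- \<lfloor>t / T\<rfloor>) * T \<in> {0..T}"
    using \<open>0 < T\<close> floor_divide_lower[of T t] floor_divide_upper[of T t] by (auto simp: algebra_simps)
  show "f (t + of_int (- \<lfloor>t / T\<rfloor>) * T) = f t"
    using per by (rule periodic_int_shift)
qed

section \<open>Basic properties of periodic traveling waves\<close>

lemma wave_at_bot:
  assumes "periodic_traveling_wave a b T c V" "0 < e"
  obtains R where "\<And>t x. x \<le> - R \<Longrightarrow> \<bar>V t x - 1\<bar> < e"
proof -
  have "\<forall>\<^sub>F x in at_bot. \<forall>t. dist (V t x) 1 < e"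
    using assms unfolding periodic_traveling_wave_def uniform_limit_iff by simp
  then obtain N where "\<And>t x. x \<le> N \<Longrightarrow> dist (V t x) 1 < e"
    unfolding eventually_at_bot_linorder by blast
  then show ?thesis
    using that[of "- N"] by (simp add: dist_real_def)
qed

lemma wave_at_top:
  assumes "periodic_traveling_wave a b T c V" "0 < e"
  obtains R where "\<And>t x. R \<le> x \<Longrightarrow> \<bar>V t x\<bar> < e"
proof -
  have "\<forall>\<^sub>F x in at_top. \<forall>t. dist (V t x) 0 < e"
    using assms unfolding periodic_traveling_wave_def uniform_limit_iff by simp
  then obtain N where "\<And>t x. N \<le> x \<Longrightarrow> dist (V t x) 0 < e"
    unfolding eventually_at_top_linorder by blast
  then show ?thesis
    using that[of N] by (simp add: dist_real_def)
qed

lemma continuous_on_wave: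
  assumes "periodic_traveling_wave a b T c V"
  shows "continuous_on UNIV (\<lambda>(t, x). V t (x - c * t))" "continuous_on UNIV (\<lambda>(t, x). V t x)"
proof -
  show *: "continuous_on UNIV (\<lambda>(t, x). V t (x - c * t))"
    using assms continuous_on_of_partial_derivatives[of "\<lambda>t x. V t (x - c * t)"]
    unfolding periodic_traveling_wave_def classical_solution_def by blast
  have "continuous_on UNIV (\<lambda>p. (\<lambda>(t, x). V t (x - c * t)) (fst p, snd p + c * fst p))"
    by (rule continuous_on_compose2[OF *]) (auto intro!: continuous_intros)
  then show "continuous_on UNIV (\<lambda>(t, x). V t x)"
    by (simp add: split_beta)
qed

lemma bistable_nonlinearity_neg:
  assumes "\<And>s. 0 < a s" "\<And>s. b s < 1" "1 < u"
  shows "bistable_nonlinearity a b T t u < 0"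
proof -
  have "0 < a (t / T) * u * (u - b (t / T))"
    using assms(1,3) assms(2)[of "t / T"] by (intro mult_pos_pos) auto
  then show ?thesis
    using \<open>1 < u\<close> by (simp add: bistable_nonlinearity_def mult_pos_neg)
qed

text \<open>Maximum principle: a value above 1 would force a global maximum above 1. There the time
  derivative vanishes, the second space derivative is nonpositive and the reaction is strictly
  negative, which contradicts the equation.\<close>

lemma wave_le_1:
  assumes wave: "periodic_traveling_wave a b T c V" and "0 < T"
    and ab: "\<And>s. 0 < a s" "\<And>s. b s < 1"
  shows "V t x \<le> 1"
proof (rule ccontr)
  assume "\<not> V t x \<le> 1"
  have per: "\<And>t. V (t + T) = V t"
    using wave by (auto simp: periodic_traveling_wave_def)
  obtain t1 where t1: "t1 \<in> {0..T}" "V t1 x > 1"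
    using periodic_representative[of V T t, OF per \<open>0 < T\<close>] \<open>\<not> V t x \<le> 1\<close> by (metis not_le)
  define m where "m = V t1 x"
  obtain R1 where R1: "\<And>t x. x \<le> - R1 \<Longrightarrow> \<bar>V t x - 1\<bar> < m - 1"
    using wave_at_bot[OF wave, of "m - 1"] t1 by (auto simp: m_def)
  obtain R2 where R2: "\<And>t x. R2 \<le> x \<Longrightarrow> \<bar>V t x\<bar> < m"
    using wave_at_top[OF wave, of m] t1 by (auto simp: m_def)
  \<comment> \<open>Outside the strip both tail estimates give values below \<open>m\<close>, and
    time can be reduced to one period. So a maximum over this compact rectangle is a maximum over
    the whole plane.\<close>
  define K where "K = {0..T} \<times> {- R1..R2}"
  have x_in: "x \<in> {- R1..R2}"
    using R1[of x t1] R2[of x t1] by (force simp: m_def)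
  have "compact K" "K \<noteq> {}"
    using t1 x_in by (auto simp: K_def compact_Times)
  moreover have "continuous_on K (\<lambda>(t, x). V t x)"
    using continuous_on_wave(2)[OF wave] continuous_on_subset by blast
  ultimately have "\<exists>p\<in>K. \<forall>q\<in>K. (\<lambda>(t, x). V t x) q \<le> (\<lambda>(t, x). V t x) p"
    by (rule continuous_attains_sup)
  then obtain p where p: "p \<in> K" "\<And>q. q \<in> K \<Longrightarrow> (\<lambda>(t, x). V t x) q \<le> (\<lambda>(t, x). V t x) p"
    by blast
  obtain t0 x0 where [simp]: "p = (t0, x0)" by fastforce
  have "m \<le> V t0 x0"
    using p(2)[of "(t1, x)"] t1 x_in by (simp add: K_def m_def)
  have max: "V t' y \<le> V t0 x0" for t' y
  proof (cases "y \<in> {- R1..R2}")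
    case True
    obtain s where "s \<in> {0..T}" "V s = V t'"
      using periodic_representative[of V T t', OF per \<open>0 < T\<close>] .
    then show ?thesis
      using p(2)[of "(s, y)"] True by (auto simp: K_def)
  next
    case False
    then show ?thesis
      using R1[of y t'] R2[of y t'] \<open>m \<le> V t0 x0\<close> by fastforce
  qed
  obtain vt vx vxx where v:
    "\<And>t x. ((\<lambda>s. V s (x - c * s)) has_real_derivative vt t x) (at t)"
    "\<And>t x. ((\<lambda>y. V t (y - c * t)) has_real_derivative vx t x) (at x)"
    "\<And>t x. ((\<lambda>y. vx t y) has_real_derivative vxx t x) (at x)"
    "\<And>t x. vt t x = vxx t x + bistable_nonlinearity a b T t (V t (x - c * t))"
    using wave unfolding periodic_traveling_wave_def classical_solution_def by blast
  \<comment> \<open>The derivatives in \<open>v\<close> live in the resting frame, where the maximum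
    point \<open>x0\<close> of the moving frame sits at \<open>z\<close> at time
    \<open>t0\<close>.\<close>
  define z where "z = x0 + c * t0"
  have "vt t0 z = 0"
    by (rule DERIV_local_max[OF v(1) zero_less_one]) (simp add: z_def max)
  moreover have "vxx t0 z \<le> 0"
    by (rule second_derivative_nonpos_at_max[OF v(2,3)]) (simp add: z_def max)
  moreover have "bistable_nonlinearity a b T t0 (V t0 (z - c * t0)) < 0"
    using \<open>m \<le> V t0 x0\<close> t1 by (intro bistable_nonlinearity_neg ab) (simp add: z_def m_def)
  ultimately show False
    using v(4)[of t0 z] by linarith
qed

section \<open>Comparison of wave speeds with strict supersolutions\<close>

text \<open>\<open>left\<close> and \<open>low\<close> keep \<open>w\<close> above the wave near
  both ends of the line, so contact can only occur in a bounded region. \<open>right\<close> makes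
  contact unavoidable if the wave is faster. Strictness of \<open>super\<close> lets the first
  contact be refuted by derivative tests alone.\<close>

lemma wave_speed_le_of_strict_supersolution:
  fixes w wt wx wxx :: "real \<Rightarrow> real \<Rightarrow> real"
  assumes "wave_speed a b T c" and "0 < T"
    and ab: "\<And>s. 0 < a s" "\<And>s. b s < 1"
    and w: "\<And>t x. ((\<lambda>s. w s x) has_real_derivative wt t x) (at t)"
      "\<And>t x. ((\<lambda>y. w t y) has_real_derivative wx t x) (at x)"
      "\<And>t x. ((\<lambda>y. wx t y) has_real_derivative wxx t x) (at x)"
      "continuous_on UNIV (\<lambda>(t, x). w t x)"
    and super: "\<And>t x. wxx t x + bistable_nonlinearity a b T t (w t x) < wt t x"
    and "0 < \<delta>"
    and low: "\<And>t x. \<delta> < w t x" and left: "\<And>t x. x \<le> s * t - M \<Longrightarrow> 1 < w t x"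
    and right: "\<And>t x. s * t + M \<le> x \<Longrightarrow> w t x \<le> 1 - \<delta>"
  shows "c \<le> s"
proof (rule ccontr)
  assume "\<not> c \<le> s"
  obtain V where wave: "periodic_traveling_wave a b T c V"
    using \<open>wave_speed a b T c\<close> by (auto simp: wave_speed_def)
  have V_le: "V t x \<le> 1" for t x
    using wave_le_1[OF wave \<open>0 < T\<close> ab] .
  obtain R1 where R1: "\<And>t x. x \<le> - R1 \<Longrightarrow> \<bar>V t x - 1\<bar> < \<delta>"
    using wave_at_bot[OF wave \<open>0 < \<delta>\<close>] by blast
  obtain R2 where R2: "\<And>t x. R2 \<le> x \<Longrightarrow> \<bar>V t x\<bar> < \<delta>"
    using wave_at_top[OF wave \<open>0 < \<delta>\<close>] by blast
  obtain vt vx vxx where v: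
    "\<And>t x. ((\<lambda>s. V s (x - c * s)) has_real_derivative vt t x) (at t)"
    "\<And>t x. ((\<lambda>y. V t (y - c * t)) has_real_derivative vx t x) (at x)"
    "\<And>t x. ((\<lambda>y. vx t y) has_real_derivative vxx t x) (at x)"
    "\<And>t x. vt t x = vxx t x + bistable_nonlinearity a b T t (V t (x - c * t))"
    using wave unfolding periodic_traveling_wave_def classical_solution_def by blast
  \<comment> \<open>With this shift the two regions where \<open>z\<close> is known to be positive,
    \<open>x \<le> S + s * t - M\<close> and \<open>R2 + c * t \<le> x\<close>, cover the whole line
    at time 0.\<close>
  define S where "S = R2 + M"
  define z where "z t x = w t (x - S) - V t (x - c * t)" for t x
  \<comment> \<open>By this time the point \<open>c * t1 - R1\<close>, where the wave exceeds
    \<open>1 - \<delta>\<close>, has reached \<open>S + s * t1 + M\<close>, beyond which the shifted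
    \<open>w\<close> is at most \<open>1 - \<delta>\<close>.\<close>
  define t1 where "t1 = max 0 ((R1 + S + M) / (c - s))"
  \<comment> \<open>Crude bound: up to time \<open>t1\<close>, every point outside
    \<open>[- L, L]\<close> lies in one of the two regions of positivity.\<close>
  define L where "L = \<bar>S\<bar> + \<bar>M\<bar> + \<bar>R2\<bar> + (\<bar>s\<bar> + \<bar>c\<bar>) * t1"
  define K where "K = {p \<in> {0..t1} \<times> {- L..L}. (\<lambda>(t, x). z t x) p \<le> 0}"

  have cont_z: "continuous_on UNIV (\<lambda>(t, x). z t x)"
  proof -
    have "continuous_on UNIV (\<lambda>p. (\<lambda>(t, x). w t x) (fst p, snd p - S))"
      by (rule continuous_on_compose2[OF w(4)]) (auto intro!: continuous_intros)
    then show ?thesis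
      using continuous_on_wave(1)[OF wave] by (auto simp: z_def split_beta intro!: continuous_intros)
  qed
  have z_pos_left: "0 < z t x" if "x \<le> S + s * t - M" for t x
    using left[of "x - S" t] V_le[of t "x - c * t"] that by (simp add: z_def)
  have z_pos_right: "0 < z t x" if "R2 + c * t \<le> x" for t x
    using low[of t "x - S"] R2[of "x - c * t" t] that by (simp add: z_def)
  have z0: "0 < z 0 x" for x
    using z_pos_left[of x 0] z_pos_right[of 0 x] by (cases "x \<le> R2") (auto simp: S_def)
  have outside: "0 < z t x" if "t \<in> {0..t1}" "x \<notin> {- L..L}" for t x
  proof -
    have "\<bar>s * t\<bar> \<le> \<bar>s\<bar> * t1" "\<bar>c * t\<bar> \<le> \<bar>c\<bar> * t1"
      using that by (simp_all add: abs_mult mult_left_mono)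
    then have "x \<le> S + s * t - M \<or> R2 + c * t \<le> x"
      using that(2) unfolding L_def atLeastAtMost_iff distrib_right by linarith
    then show ?thesis
      using z_pos_left z_pos_right by blast
  qed
  have "compact K"
  proof -
    have "closed {p. (\<lambda>(t, x). z t x) p \<le> 0}"
      using closed_Collect_le[OF cont_z continuous_on_const] .
    then have "compact (({0..t1} \<times> {- L..L}) \<inter> {p. (\<lambda>(t, x). z t x) p \<le> 0})"
      by (intro compact_Int_closed compact_Times) auto
    moreover have "K = ({0..t1} \<times> {- L..L}) \<inter> {p. (\<lambda>(t, x). z t x) p \<le> 0}"
      by (auto simp: K_def)
    ultimately show ?thesis by simp
  qed
  moreover have "K \<noteq> {}"
  proof -
    define x1 where "x1 = c * t1 - R1"
    have "R1 + S + M \<le> (c - s) * t1"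
      using \<open>\<not> c \<le> s\<close> by (simp add: t1_def max_def field_simps)
    then have "z t1 x1 \<le> 0"
      using right[of t1 "x1 - S"] R1[of "x1 - c * t1" t1] by (simp add: z_def x1_def algebra_simps)
    moreover have "t1 \<in> {0..t1}"
      by (simp add: t1_def)
    ultimately show ?thesis
      using outside[of t1 x1] by (force simp: K_def)
  qed
  \<comment> \<open>The first contact is a point of least time in the compact set of
    contacts.\<close>
  ultimately have "\<exists>p\<in>K. \<forall>q\<in>K. fst p \<le> fst q"
    by (intro continuous_attains_inf) (auto intro!: continuous_intros)
  then obtain p where p: "p \<in> K" "\<And>q. q \<in> K \<Longrightarrow> fst p \<le> fst q"
    by blast
  obtain t0 x0 where [simp]: "p = (t0, x0)" by fastforce
  have t0: "0 < t0" "t0 \<le> t1" and "z t0 x0 \<le> 0"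
    using p(1) z0[of x0] by (auto simp: K_def less_le)
  have before: "0 < z t x" if "0 \<le> t" "t < t0" for t x
    using p(2)[of "(t, x)"] outside[of t x] that t0 by (force simp: K_def)
  have at_t0: "0 \<le> z t0 x" for x
  proof (rule tendsto_lowerbound)
    have "continuous_on UNIV (\<lambda>t. (\<lambda>(t, x). z t x) (t, x))"
      by (rule continuous_on_compose2[OF cont_z]) (auto intro!: continuous_intros)
    then have "((\<lambda>t. z t x) \<longlongrightarrow> z t0 x) (at t0)"
      by (simp add: continuous_on_def)
    then show "((\<lambda>t. z t x) \<longlongrightarrow> z t0 x) (at_left t0)"
      by (simp add: filterlim_at_split)
    show "\<forall>\<^sub>F t in at_left t0. 0 \<le> z t x"
      unfolding eventually_at_left[OF t0(1)] using before less_imp_le t0(1) by blast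
  qed auto
  have "z t0 x0 = 0"
    using at_t0[of x0] \<open>z t0 x0 \<le> 0\<close> by simp
  have zt: "((\<lambda>t. z t x0) has_real_derivative (wt t0 (x0 - S) - vt t0 x0)) (at t0)"
    unfolding z_def by (intro DERIV_diff w v)
  have shift: "((\<lambda>y. f (y - S)) has_real_derivative f') (at x)"
    if "(f has_real_derivative f') (at (x - S))" for f f' x
    using that DERIV_shift[of f f' x "- S"] by simp
  have "0 \<le> wxx t0 (x0 - S) - vxx t0 x0"
  proof (rule second_derivative_nonneg_at_min)
    show "((\<lambda>x. z t0 x) has_real_derivative (wx t0 (y - S) - vx t0 y)) (at y)" for y
      unfolding z_def by (intro DERIV_diff v shift w)
    show "((\<lambda>y. wx t0 (y - S) - vx t0 y) has_real_derivative wxx t0 (x0 - S) - vxx t0 x0) (at x0)"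
      by (intro DERIV_diff v shift w)
    show "z t0 x0 \<le> z t0 y" for y
      using at_t0 \<open>z t0 x0 = 0\<close> by simp
  qed
  \<comment> \<open>At contact both reaction terms coincide. Since \<open>z\<close> has a spatial
    minimum there, strictness of \<open>super\<close> makes \<open>z\<close> strictly increasing in
    time, so \<open>z\<close> was negative just before \<open>t0\<close>.\<close>
  moreover have "w t0 (x0 - S) = V t0 (x0 - c * t0)"
    using \<open>z t0 x0 = 0\<close> by (simp add: z_def)
  ultimately have "0 < wt t0 (x0 - S) - vt t0 x0"
    using super[of t0 "x0 - S"] v(4)[of t0 x0] by simp
  then obtain e where e: "e > 0" "\<And>h. 0 < h \<Longrightarrow> h < e \<Longrightarrow> z (t0 - h) x0 < z t0 x0"
    using DERIV_pos_inc_left[OF zt] by auto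
  \<comment> \<open>The cap by \<open>t0\<close> keeps \<open>t0 - h\<close> nonnegative, where
    \<open>before\<close> applies.\<close>
  define h where "h = min (e / 2) t0"
  have "0 < h" "h < e" "h \<le> t0"
    using e(1) t0 by (auto simp: h_def)
  then have "z (t0 - h) x0 < 0" "0 < z (t0 - h) x0"
    using e(2)[of h] \<open>z t0 x0 = 0\<close> before[of "t0 - h" x0] by simp_all
  then show False by simp
qed

section \<open>The logistic profile and the lifted cubic\<close>

text \<open>It satisfies \<open>front' = - front (1 - front)\<close>, so all derivatives of a front
  are polynomials in the front itself. Differential inequalities thereby become polynomial
  inequalities.\<close>

definition front :: "real \<Rightarrow> real" where
  "front y = 1 / (1 + exp y)"

lemma front_gt_0: "0 < front y" and front_less_1: "front y < 1"
  by (simp_all add: front_def add_pos_pos field_simps)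

lemma front_minus: "front (- y) = 1 - front y"
proof -
  have "1 + exp y \<noteq> 0"
    by (smt (verit) exp_gt_zero)
  then show ?thesis
    by (simp add: front_def exp_minus field_simps)
qed

lemma has_real_derivative_front [derivative_intros]:
  assumes "(f has_real_derivative D) (at x)"
  shows "((\<lambda>x. front (f x)) has_real_derivative - (front (f x) * (1 - front (f x)) * D)) (at x)"
proof -
  have "1 + exp (f x) \<noteq> 0"
    by (smt (verit) exp_gt_zero)
  then show ?thesis
    unfolding front_def using assms
    by (auto intro!: derivative_eq_intros simp: field_simps power2_eq_square)
qed

lemma continuous_on_front [continuous_intros]:
  assumes "continuous_on S f"
  shows "continuous_on S (\<lambda>x. front (f x))"
proof -
  have "1 + exp y \<noteq> 0" for y :: real
    by (smt (verit) exp_gt_zero)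
  then show ?thesis
    unfolding front_def using assms by (auto intro!: continuous_intros)
qed

lemma front_le_inverse:
  assumes "0 < y"
  shows "front y \<le> 1 / y"
proof -
  have "y \<le> 1 + exp y"
    using exp_ge_add_one_self[of y] by linarith
  then show ?thesis
    using assms by (simp add: front_def frac_le)
qed

text \<open>When the steepness of a front varies in time, its time derivative contains the unbounded
  distance to the centre. The decay of the profile, \<open>front y \<le> 1 / y\<close> for positive
  \<open>y\<close>, compensates this factor; negative \<open>y\<close> follow by symmetry.\<close>

lemma front_times_abs_le_1: "front y * (1 - front y) * \<bar>y\<bar> \<le> 1"
proof -
  have pos: "front y * (1 - front y) * y \<le> 1" if "0 < y" for y
  proof -
    have "front y * y \<le> 1"
      using front_le_inverse[OF that] that by (simp add: le_divide_eq)
    then have "front y * y * (1 - front y) \<le> 1 * 1"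
      using front_gt_0[of y] front_less_1[of y] by (intro mult_mono) simp_all
    then show ?thesis by (simp add: mult_ac)
  qed
  show ?thesis
  proof (cases y "0 :: real" rule: linorder_cases)
    case less
    then show ?thesis
      using pos[of "- y"] by (simp add: front_minus mult_ac)
  qed (use pos in auto)
qed

lemma front_small:
  assumes "0 < e"
  shows "1 / e \<le> y \<Longrightarrow> front y \<le> e" "y \<le> - (1 / e) \<Longrightarrow> 1 - e \<le> front y"
proof -
  have *: "front y \<le> e" if "1 / e \<le> y" for y
  proof -
    have "0 < 1 / e" using assms by simp
    then have "0 < y" using that by linarith
    then have "1 / y \<le> e"
      using that assms by (simp add: field_simps)
    then show ?thesis
      using front_le_inverse[OF \<open>0 < y\<close>] by linarith
  qed
  then show "1 / e \<le> y \<Longrightarrow> front y \<le> e" .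
  show "y \<le> - (1 / e) \<Longrightarrow> 1 - e \<le> front y"
    using *[of "- y"] by (simp add: front_minus)
qed

text \<open>To first order in \<epsilon>, the lift costs the derivative of the cubic and lowering
  \<beta> by \<open>3 * \<epsilon>\<close> gains \<open>3 * y * (1 - y)\<close>. The factor 3
  cancels the quadratic terms and leaves the interpolation
  \<open>(1 - y) * \<beta> + y * (1 - \<beta>)\<close>, which is at least \<open>m\<close>. The
  higher-order remainder costs at most half of that.\<close>

lemma cubic_shift_gap:
  fixes y \<beta> m \<epsilon> :: real
  assumes y: "0 \<le> y" "y \<le> 1" and m: "m \<le> \<beta>" "\<beta> \<le> 1 - m" and \<epsilon>: "0 < \<epsilon>" "\<epsilon> \<le> m / 4"
  shows "(\<epsilon> + y) * (\<epsilon> + y - \<beta>) * (1 - (\<epsilon> + y)) + \<epsilon> * m / 2 \<le> y * (y - \<beta> + 3 * \<epsilon>) * (1 - y)"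
proof -
  have "y * (y - \<beta> + 3 * \<epsilon>) * (1 - y) - (\<epsilon> + y) * (\<epsilon> + y - \<beta>) * (1 - (\<epsilon> + y))
      = \<epsilon> * ((1 - y) * \<beta> + y * (1 - \<beta>) + \<epsilon> * (3 * y + \<epsilon> - 1 - \<beta>))"
    by algebra
  moreover have "m / 2 \<le> (1 - y) * \<beta> + y * (1 - \<beta>) + \<epsilon> * (3 * y + \<epsilon> - 1 - \<beta>)"
  proof -
    have "(1 - y) * m + y * m \<le> (1 - y) * \<beta> + y * (1 - \<beta>)"
      using y m by (intro add_mono mult_left_mono) auto
    moreover have "\<epsilon> * (- 2) \<le> \<epsilon> * (3 * y + \<epsilon> - 1 - \<beta>)"
      using y m \<epsilon> by (intro mult_left_mono) auto
    ultimately show ?thesis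
      using \<epsilon> by (simp add: algebra_simps)
  qed
  then have "\<epsilon> * (m / 2) \<le> \<epsilon> * ((1 - y) * \<beta> + y * (1 - \<beta>) + \<epsilon> * (3 * y + \<epsilon> - 1 - \<beta>))"
    using \<epsilon> by (intro mult_left_mono) auto
  ultimately show ?thesis by (simp only: times_divide_eq_right)
qed

section \<open>Bounds and primitives of periodic functions\<close>

lemma periodic_abs_bounded:
  fixes f :: "real \<Rightarrow> real"
  assumes "\<And>s. f (s + 1) = f s" "continuous_on UNIV f"
  obtains K where "1 \<le> K" "\<And>s. \<bar>f s\<bar> \<le> K"
proof -
  have "bounded (f ` {0..1})"
    using assms(2) by (intro compact_imp_bounded compact_continuous_image)
      (auto intro: continuous_on_subset)
  then obtain K where K: "\<And>s. s \<in> {0..1} \<Longrightarrow> \<bar>f s\<bar> \<le> K"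
    unfolding bounded_iff real_norm_def by blast
  have "\<bar>f s\<bar> \<le> max 1 K" for s
  proof -
    obtain r where "r \<in> {0..1}" "f r = f s"
      using periodic_representative[of f 1 s] assms(1) by auto
    then show ?thesis using K[of r] by simp
  qed
  then show ?thesis using that[of "max 1 K"] by simp
qed

lemma periodic_pos_lower_bound:
  fixes f :: "real \<Rightarrow> real"
  assumes "\<And>s. f (s + 1) = f s" "continuous_on UNIV f" "\<And>s. 0 < f s"
  obtains l where "0 < l" "\<And>s. l \<le> f s"
proof -
  have "\<exists>r\<in>{0..1}. \<forall>s\<in>{0..1}. f r \<le> f s"
    using assms(2) by (intro continuous_attains_inf) (auto intro: continuous_on_subset)
  then obtain r where r: "\<And>s. s \<in> {0..1} \<Longrightarrow> f r \<le> f s"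
    by blast
  have "f r \<le> f s" for s
  proof -
    obtain q where "q \<in> {0..1}" "f q = f s"
      using periodic_representative[of f 1 s] assms(1) by auto
    then show ?thesis using r[of q] by simp
  qed
  then show ?thesis using that assms(3) by blast
qed

lemma periodic_pos_integral:
  fixes f :: "real \<Rightarrow> real"
  assumes "\<And>s. f (s + 1) = f s" "continuous_on UNIV f" "\<And>s. 0 < f s"
  shows "0 < integral {0..1} f"
proof -
  obtain l where l: "0 < l" "\<And>s. l \<le> f s"
    using periodic_pos_lower_bound[of f] assms by auto
  have "f integrable_on {0..1}"
    using assms(2) by (intro integrable_continuous_real) (auto intro: continuous_on_subset)
  then have "integral {0..1} (\<lambda>s::real. l) \<le> integral {0..1} f"
    using l by (intro integral_le) auto
  then show ?thesis using l by simp
qed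

text \<open>Subtracting the mean makes the integral over one period vanish, so the primitive is
  itself periodic, hence bounded. Such primitives serve as correctors of size \<open>T\<close> for
  both limits.\<close>

lemma periodic_mean_primitive:
  fixes f :: "real \<Rightarrow> real"
  assumes per: "\<And>s. f (s + 1) = f s" and cont: "continuous_on UNIV f"
  obtains G K where "\<And>s. (G has_real_derivative (f s - integral {0..1} f)) (at s)"
    "1 \<le> K" "\<And>s. \<bar>G s\<bar> \<le> K"
proof -
  define g where "g s = f s - integral {0..1} f" for s
  have cont_g: "continuous_on UNIV g"
    unfolding g_def by (intro continuous_intros cont)
  obtain G where "\<And>s. (G has_vector_derivative g s) (at s)"
    using einterval_antiderivative[of "-\<infinity>" "\<infinity>" g] cont_g
    by (auto simp: continuous_on_eq_continuous_at)
  then have G: "(G has_real_derivative g s) (at s)" for s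
    by (simp add: has_real_derivative_iff_has_vector_derivative)
  have int_f: "f integrable_on {0..1}"
    using cont by (intro integrable_continuous_real) (auto intro: continuous_on_subset)
  have "(g has_integral (G 1 - G 0)) {0..1}"
    using G by (intro fundamental_theorem_of_calculus)
      (auto simp: has_real_derivative_iff_has_vector_derivative[symmetric] intro: DERIV_subset)
  moreover have "(g has_integral (integral {0..1} f - integral {0..1} f)) {0..1}"
    unfolding g_def using has_integral_const_real[of "integral {0..1} f" 0 1] int_f
    by (intro has_integral_diff) (auto simp: has_integral_integral)
  ultimately have "G 1 - G 0 = integral {0..1} f - integral {0..1} f"
    by (rule has_integral_unique)
  then have "G 1 = G 0" by simp
  have "((\<lambda>s. G (s + 1) - G s) has_real_derivative 0) (at s)" for s
  proof -
    have "((\<lambda>s. G (s + 1)) has_real_derivative g s) (at s)"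
      using G[of "s + 1"] per[of s] by (simp add: DERIV_shift g_def)
    from DERIV_diff[OF this G] show ?thesis by simp
  qed
  then have "G (s + 1) - G s = G (0 + 1) - G 0" for s
    using DERIV_isconst_all[of "\<lambda>s. G (s + 1) - G s" s 0] by simp
  then have "G (s + 1) = G s" for s
    using \<open>G 1 = G 0\<close> by simp
  moreover have "continuous_on UNIV G"
    using G by (meson DERIV_isCont continuous_at_imp_continuous_on)
  ultimately obtain K where "1 \<le> K" "\<And>s. \<bar>G s\<bar> \<le> K"
    using periodic_abs_bounded by blast
  then show ?thesis
    using that G unfolding g_def by blast
qed

section \<open>Upper bound on the speed for large periods\<close>

lemma eventually_wave_speed_le_slow:
  fixes a b :: "real \<Rightarrow> real"
  assumes a_C1: "a C1_differentiable_on UNIV" and cont_b: "continuous_on UNIV b"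
    and per: "\<And>s. a (s + 1) = a s" "\<And>s. b (s + 1) = b s"
    and a_pos: "\<And>s. 0 < a s" and b: "\<And>s. 0 < b s" "\<And>s. b s < 1"
    and "0 < \<eta>"
  shows "\<forall>\<^sub>F T in at_top. \<forall>c. wave_speed a b T c \<longrightarrow>
    c \<le> integral {0..1} (\<lambda>s. sqrt (2 * a s) * (1 / 2 - b s)) + \<eta>"
proof -
  obtain a' where a': "\<And>s. (a has_real_derivative a' s) (at s)" and cont_a': "continuous_on UNIV a'"
    using a_C1 by (auto simp: C1_differentiable_on_def has_real_derivative_iff_has_vector_derivative)
  have cont_a: "continuous_on UNIV a"
    using a_C1 by (rule C1_differentiable_imp_continuous_on)
  define k where "k s = sqrt (a s / 2)" for s
  define k' where "k' s = a' s / (4 * k s)" for s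
  have k_pos: "0 < k s" for s
    using a_pos by (simp add: k_def)
  have k: "(k has_real_derivative k' s) (at s)" for s
    unfolding k_def k'_def using a_pos[of s]
    by (auto intro!: derivative_eq_intros a' simp: field_simps)
  have k2: "k s * k s = a s / 2" for s
    using a_pos[of s] by (simp add: k_def)
  have cont_k: "continuous_on UNIV k"
    unfolding k_def by (intro continuous_intros cont_a) auto
  have "a' (s + 1) = a' s" for s
  proof -
    have "((\<lambda>x. a (x + 1)) has_real_derivative a' (s + 1)) (at s)"
      using a'[of "s + 1"] by (simp add: DERIV_shift)
    then show ?thesis
      using a'[of s] per(1) by (auto dest: DERIV_unique)
  qed
  then have "k' (s + 1) = k' s" for s
    by (simp add: k'_def k_def per)
  moreover have "continuous_on UNIV k'"
    unfolding k'_def by (intro continuous_intros cont_a' cont_k) (use k_pos in \<open>simp add: less_imp_neq[symmetric]\<close>)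
  ultimately obtain K' where K': "1 \<le> K'" "\<And>s. \<bar>k' s\<bar> \<le> K'"
    using periodic_abs_bounded by blast
  obtain k0 where k0: "0 < k0" "\<And>s. k0 \<le> k s"
    using periodic_pos_lower_bound[of k] per(1) cont_k k_pos by (auto simp: k_def)
  obtain a0 where a0: "0 < a0" "\<And>s. a0 \<le> a s"
    using periodic_pos_lower_bound[of a] per(1) cont_a a_pos by auto
  have "continuous_on UNIV (\<lambda>s. min (b s) (1 - b s))"
    by (intro continuous_intros cont_b)
  then obtain m where m: "0 < m" "\<And>s. m \<le> min (b s) (1 - b s)"
    using periodic_pos_lower_bound[of "\<lambda>s. min (b s) (1 - b s)"] per(2) b by auto
  define J where "J = integral {0..1} (\<lambda>s. sqrt (2 * a s))"
  have "0 \<le> J"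
    unfolding J_def using a_pos by (intro integral_nonneg integrable_continuous_real continuous_intros
      continuous_on_subset[OF cont_a]) (auto simp: less_imp_le)
  \<comment> \<open>The three bounds serve, in order, \<open>cubic_shift_gap\<close>, the room below
    1 on the right, and \<open>Q_le\<close>. Using \<open>J + 1\<close> avoids division by
    zero.\<close>
  define \<epsilon> where "\<epsilon> = min (min (m / 4) (1 / 4)) (\<eta> / (3 * (J + 1)))"
  have \<epsilon>: "0 < \<epsilon>" "\<epsilon> \<le> m / 4" "\<epsilon> \<le> 1 / 4" "\<epsilon> \<le> \<eta> / (3 * (J + 1))"
    unfolding \<epsilon>_def using m(1) \<open>0 < \<eta>\<close> \<open>0 \<le> J\<close> by (simp_all only: min_less_iff_conj min.cobounded1 min.cobounded2 min.coboundedI1) simp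
  define q where "q s = sqrt (2 * a s) * (1 / 2 - b s + 3 * \<epsilon>)" for s
  define Q where "Q = integral {0..1} q"
  have cont_q: "continuous_on UNIV q"
    unfolding q_def by (intro continuous_intros cont_a cont_b)
  have kq: "k s * q s = a s * (1 / 2 - b s + 3 * \<epsilon>)" for s
    using a_pos[of s] by (simp add: k_def q_def flip: real_sqrt_mult)
  have Q_le: "Q \<le> integral {0..1} (\<lambda>s. sqrt (2 * a s) * (1 / 2 - b s)) + \<eta>"
  proof -
    have "Q = integral {0..1} (\<lambda>s. sqrt (2 * a s) * (1 / 2 - b s) + 3 * \<epsilon> * sqrt (2 * a s))"
      unfolding Q_def q_def by (simp add: algebra_simps)
    also have "\<dots> = integral {0..1} (\<lambda>s. sqrt (2 * a s) * (1 / 2 - b s)) + 3 * \<epsilon> * J"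
      unfolding J_def by (subst integral_add) (auto intro!: integrable_continuous_real continuous_intros
        continuous_on_subset[OF cont_a] continuous_on_subset[OF cont_b])
    also have "3 * \<epsilon> * J \<le> 3 * \<epsilon> * (J + 1)"
      using \<epsilon>(1) by simp
    also have "3 * \<epsilon> * (J + 1) \<le> \<eta>"
      using \<epsilon>(4) \<open>0 \<le> J\<close> by (simp add: field_simps)
    finally show ?thesis by simp
  qed
  obtain G KG where G: "\<And>s. (G has_real_derivative (q s - Q)) (at s)"
    and KG: "1 \<le> KG" "\<And>s. \<bar>G s\<bar> \<le> KG"
    using periodic_mean_primitive[of q] cont_q per unfolding Q_def by (auto simp: q_def)
  have cont_G: "continuous_on UNIV G"
    using G by (meson DERIV_isCont continuous_at_imp_continuous_on)
  \<comment> \<open>Beyond \<open>T0\<close> the steepness error \<open>K' / (k0 * T)\<close> is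
    smaller than the margin \<open>a0 * (\<epsilon> * m / 2)\<close>.\<close>
  define T0 where "T0 = 2 * K' / (k0 * a0 * \<epsilon> * m)"
  have bound: "c \<le> Q" if "max T0 0 < T" and speed: "wave_speed a b T c" for T c
  proof -
    have T: "0 < T" "T0 < T" using that by auto
    \<comment> \<open>The centre of the front: its velocity is exactly \<open>q (t / T)\<close>, yet
      it stays within \<open>T * KG\<close> of uniform motion.\<close>
    define X where "X t = Q * t + T * G (t / T)" for t
    define P where "P t x = front (k (t / T) * (x - X t))" for t x
    define w where "w t x = \<epsilon> + P t x" for t x
    define wt where "wt t x = - (P t x * (1 - P t x) *
      (k' (t / T) / T * (x - X t) - k (t / T) * q (t / T)))" for t x
    define wx where "wx t x = - (P t x * (1 - P t x) * k (t / T))" for t x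
    define wxx where "wxx t x = k (t / T) * k (t / T) * (P t x * (1 - P t x) * (1 - 2 * P t x))" for t x
    have P: "0 < P t x" "P t x < 1" for t x
      by (simp_all add: P_def front_gt_0 front_less_1)
    have kT: "((\<lambda>t. k (t / T)) has_real_derivative k' (t / T) / T) (at t)" for t
      using DERIV_chain2[OF k DERIV_cdivide[OF DERIV_ident, of T]] by (simp add: mult.commute)
    have X: "(X has_real_derivative q (t / T)) (at t)" for t
    proof -
      have "((\<lambda>t. G (t / T)) has_real_derivative (q (t / T) - Q) / T) (at t)"
        using DERIV_chain2[OF G DERIV_cdivide[OF DERIV_ident, of T]] by (simp add: mult.commute)
      then show ?thesis
        unfolding X_def using T by (auto intro!: derivative_eq_intros)
    qed
    have X_close: "\<bar>X t - Q * t\<bar> \<le> T * KG" for t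
      using T KG(2)[of "t / T"] by (simp add: X_def abs_mult)
    \<comment> \<open>The first summand covers the wandering of the centre, the second the distance
      at which the front is within \<open>\<epsilon> / 2\<close> of its limits.\<close>
    define M where "M = T * KG + 1 / (k0 * (\<epsilon> / 2))"
    show ?thesis
    proof (rule wave_speed_le_of_strict_supersolution[OF speed \<open>0 < T\<close> a_pos b(2)])
      show "((\<lambda>s. w s x) has_real_derivative wt t x) (at t)" for t x
        unfolding w_def P_def wt_def
        by (rule derivative_eq_intros kT X refl)+ (simp add: mult.commute)
      have Px: "((\<lambda>y. P t y) has_real_derivative wx t x) (at x)" for t x
        unfolding P_def wx_def by (auto intro!: derivative_eq_intros)
      then show "((\<lambda>y. w t y) has_real_derivative wx t x) (at x)" for t x
        unfolding w_def by (auto intro!: derivative_eq_intros)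
      show "((\<lambda>y. wx t y) has_real_derivative wxx t x) (at x)" for t x
        unfolding wx_def[of t] by (auto intro!: derivative_eq_intros Px simp: wx_def wxx_def algebra_simps)
      show "continuous_on UNIV (\<lambda>(t, x). w t x)"
        unfolding w_def P_def X_def split_beta
        by (intro continuous_intros continuous_on_compose2[OF cont_k] continuous_on_compose2[OF cont_G])
          (use T in auto)
      show "\<epsilon> < w t x" for t x
        using P by (simp add: w_def)
      have far: "1 / (\<epsilon> / 2) \<le> k (t / T) * y" if "1 / (k0 * (\<epsilon> / 2)) \<le> y" for t y
      proof -
        have "k0 * (1 / (k0 * (\<epsilon> / 2))) \<le> k (t / T) * y"
          using that k0(1) k0(2)[of "t / T"] \<epsilon>(1) by (intro mult_mono) auto
        then show ?thesis using k0(1) by simp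
      qed
      show "1 < w t x" if "x \<le> Q * t - M" for t x
      proof -
        have "1 / (\<epsilon> / 2) \<le> k (t / T) * (X t - x)"
          using that X_close[of t] by (intro far) (auto simp: M_def)
        then have "k (t / T) * (x - X t) \<le> - (1 / (\<epsilon> / 2))"
          by (simp only: right_diff_distrib)
        then have "1 - \<epsilon> / 2 \<le> P t x"
          unfolding P_def using \<epsilon>(1) by (intro front_small(2)) simp_all
        then show ?thesis using \<epsilon>(1) by (simp add: w_def)
      qed
      show "w t x \<le> 1 - \<epsilon>" if "Q * t + M \<le> x" for t x
      proof -
        have "1 / (\<epsilon> / 2) \<le> k (t / T) * (x - X t)"
          using that X_close[of t] by (intro far) (auto simp: M_def)
        then have "P t x \<le> \<epsilon> / 2"
          unfolding P_def using \<epsilon>(1) by (intro front_small(1)) simp_all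
        then show ?thesis using \<epsilon> by (simp add: w_def)
      qed
      show "wxx t x + bistable_nonlinearity a b T t (w t x) < wt t x" for t x
      proof -
        define \<tau> p where "\<tau> = t / T" and "p = P t x"
        have p: "0 < p" "p < 1" using P by (auto simp: p_def)
        have "wt t x - wxx t x = p * (1 - p) * (k \<tau> * q \<tau> - k \<tau> * k \<tau> * (1 - 2 * p))
            - p * (1 - p) * (x - X t) * k' \<tau> / T"
          by (simp add: wt_def wxx_def p_def \<tau>_def algebra_simps)
        also have "p * (1 - p) * (k \<tau> * q \<tau> - k \<tau> * k \<tau> * (1 - 2 * p)) = a \<tau> * (p * (p - b \<tau> + 3 * \<epsilon>) * (1 - p))"
          unfolding k2 kq by algebra
        finally have eq: "wt t x - wxx t x = a \<tau> * (p * (p - b \<tau> + 3 * \<epsilon>) * (1 - p))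
          - p * (1 - p) * (x - X t) * k' \<tau> / T" .
        have "a \<tau> * ((\<epsilon> + p) * (\<epsilon> + p - b \<tau>) * (1 - (\<epsilon> + p)) + \<epsilon> * m / 2)
            \<le> a \<tau> * (p * (p - b \<tau> + 3 * \<epsilon>) * (1 - p))"
          using p m(2)[of \<tau>] \<epsilon> a_pos[of \<tau>] by (intro mult_left_mono cubic_shift_gap) auto
        then have gap: "bistable_nonlinearity a b T t (w t x) + a \<tau> * (\<epsilon> * m / 2)
            \<le> a \<tau> * (p * (p - b \<tau> + 3 * \<epsilon>) * (1 - p))"
          by (simp add: bistable_nonlinearity_def w_def p_def \<tau>_def algebra_simps)
        have "p * (1 - p) * (x - X t) * k' \<tau> / T \<le> K' / (k0 * T)"
        proof -
          have "p * (1 - p) * \<bar>x - X t\<bar> * k \<tau> \<le> 1"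
            using front_times_abs_le_1[of "k \<tau> * (x - X t)"] k_pos[of \<tau>]
            by (simp add: p_def P_def \<tau>_def abs_mult mult_ac)
          then have "p * (1 - p) * \<bar>x - X t\<bar> \<le> 1 / k \<tau>"
            using k_pos[of \<tau>] by (simp add: field_simps)
          also have "\<dots> \<le> 1 / k0"
            using k0 by (intro divide_left_mono) (auto intro: mult_pos_pos k_pos)
          finally have "p * (1 - p) * \<bar>x - X t\<bar> * \<bar>k' \<tau>\<bar> \<le> 1 / k0 * K'"
            using K' k0 p by (intro mult_mono) auto
          moreover have "p * (1 - p) * (x - X t) * k' \<tau> \<le> \<bar>p * (1 - p) * (x - X t) * k' \<tau>\<bar>"
            by (rule abs_ge_self)
          moreover have "\<bar>p * (1 - p) * (x - X t) * k' \<tau>\<bar> = p * (1 - p) * \<bar>x - X t\<bar> * \<bar>k' \<tau>\<bar>"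
            using p by (simp add: abs_mult)
          ultimately have "p * (1 - p) * (x - X t) * k' \<tau> \<le> K' / k0"
            by simp
          from divide_right_mono[OF this, of T] show ?thesis
            using T by simp
        qed
        also have "K' / (k0 * T) < a0 * (\<epsilon> * m / 2)"
          using T(2) T(1) k0(1) a0(1) \<epsilon>(1) m(1) by (simp add: T0_def field_simps)
        also have "\<dots> \<le> a \<tau> * (\<epsilon> * m / 2)"
          using a0(2)[of \<tau>] \<epsilon>(1) m(1) by (intro mult_right_mono) auto
        finally show ?thesis
          using eq gap by linarith
      qed
    qed (use \<epsilon> in auto)
  qed
  have "\<forall>\<^sub>F T in at_top. max T0 0 < T"
    by (rule eventually_gt_at_top)
  then show ?thesis
    by eventually_elim (use bound Q_le in force)
qed

section \<open>Upper bound on the speed for small periods\<close>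

text \<open>Averaging \<open>a s * u * (u - b s) * (1 - u)\<close> over a period gives
  \<open>am * u * (u - bm) * (1 - u)\<close>, where \<open>bm\<close> is the mean of
  \<open>b\<close> weighted by \<open>a\<close>; this explains the form of the limit. The lifted
  front \<open>W\<close> of the averaged equation, with \<open>bm\<close> lowered, has a fixed
  margin, and the corrected profile stays a strict supersolution because all errors are of order
  \<open>T\<close>.\<close>

lemma eventually_wave_speed_le_fast:
  fixes a b :: "real \<Rightarrow> real"
  assumes cont_a: "continuous_on UNIV a" and cont_b: "continuous_on UNIV b"
    and per: "\<And>s. a (s + 1) = a s" "\<And>s. b (s + 1) = b s"
    and a_pos: "\<And>s. 0 < a s" and b: "\<And>s. 0 < b s" "\<And>s. b s < 1"
    and "0 < \<eta>"
  shows "\<forall>\<^sub>F T in at_right 0. \<forall>c. wave_speed a b T c \<longrightarrow>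
    c \<le> sqrt (2 * integral {0..1} a) *
      (1 / 2 - integral {0..1} (\<lambda>s. a s * b s) / integral {0..1} a) + \<eta>"
proof -
  define am where "am = integral {0..1} a"
  define bm where "bm = integral {0..1} (\<lambda>s. a s * b s) / am"
  obtain a1 where a1: "1 \<le> a1" "\<And>s. \<bar>a s\<bar> \<le> a1"
    using periodic_abs_bounded[of a] per(1) cont_a by auto
  have "continuous_on UNIV (\<lambda>s. min (b s) (1 - b s))"
    by (intro continuous_intros cont_b)
  then obtain m where m: "0 < m" "\<And>s. m \<le> min (b s) (1 - b s)"
    using periodic_pos_lower_bound[of "\<lambda>s. min (b s) (1 - b s)"] per(2) b by auto
  note int = integrable_continuous_real[OF continuous_on_subset[of UNIV _ "{0..1::real}"]]
  have int_a: "a integrable_on {0..1}"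
    by (rule int) (auto intro: cont_a)
  have int_ab: "(\<lambda>s. a s * b s) integrable_on {0..1}"
    by (rule int) (auto intro!: continuous_intros cont_a cont_b)
  have am_pos: "0 < am"
    unfolding am_def using per(1) cont_a a_pos by (intro periodic_pos_integral)
  \<comment> \<open>The weighted mean inherits the distance of \<open>b\<close> from 0 and 1, as
    \<open>cubic_shift_gap\<close> requires.\<close>
  have bm: "m \<le> bm" "bm \<le> 1 - m"
  proof -
    have "integral {0..1} (\<lambda>s. m * a s) \<le> integral {0..1} (\<lambda>s. a s * b s)"
      using m(2) a_pos int_a int_ab
      by (intro integral_le) (auto simp: mult.commute[of m] less_imp_le intro!: mult_left_mono integrable_on_mult_left)
    then show "m \<le> bm"
      using am_pos by (simp add: bm_def am_def field_simps)
    have "b s \<le> 1 - m" for s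
      using m(2)[of s] by simp
    then have "integral {0..1} (\<lambda>s. a s * b s) \<le> integral {0..1} (\<lambda>s. (1 - m) * a s)"
      using a_pos int_a int_ab
      by (intro integral_le) (auto simp: mult.commute[of "1 - m"] less_imp_le intro!: mult_left_mono integrable_on_mult_left)
    then have "integral {0..1} (\<lambda>s. a s * b s) \<le> (1 - m) * am"
      by (simp add: am_def)
    then show "bm \<le> 1 - m"
      using am_pos by (simp add: bm_def pos_divide_le_eq)
  qed
  have ambm: "integral {0..1} (\<lambda>s. a s * b s) = am * bm"
    using am_pos by (simp add: bm_def)
  obtain A KA where A: "\<And>s. (A has_real_derivative (a s - am)) (at s)"
    and KA: "1 \<le> KA" "\<And>s. \<bar>A s\<bar> \<le> KA"
    using periodic_mean_primitive[of a] per cont_a unfolding am_def by auto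
  have "continuous_on UNIV (\<lambda>s. a s * b s)"
    by (intro continuous_intros cont_a cont_b)
  then obtain B KB where B: "\<And>s. (B has_real_derivative (a s * b s - am * bm)) (at s)"
    and KB: "1 \<le> KB" "\<And>s. \<bar>B s\<bar> \<le> KB"
    using periodic_mean_primitive[of "\<lambda>s. a s * b s"] per unfolding ambm by auto
  have cont_AB: "continuous_on UNIV A" "continuous_on UNIV B"
    using A B by (meson DERIV_isCont continuous_at_imp_continuous_on)+
  define K where "K = max KA KB"
  have K: "1 \<le> K" "\<And>s. \<bar>A s\<bar> \<le> K" "\<And>s. \<bar>B s\<bar> \<le> K"
    using KA KB by (auto simp: K_def le_max_iff_disj)
  define J where "J = sqrt (2 * am)"
  have "0 < J" using am_pos by (simp add: J_def)
  define \<epsilon> where "\<epsilon> = min (min (m / 4) (1 / 4)) (\<eta> / (3 * J))"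
  have \<epsilon>: "0 < \<epsilon>" "\<epsilon> \<le> m / 4" "\<epsilon> \<le> 1 / 4" "\<epsilon> \<le> \<eta> / (3 * J)"
    unfolding \<epsilon>_def using m(1) \<open>0 < \<eta>\<close> \<open>0 < J\<close>
    by (simp_all only: min_less_iff_conj min.cobounded1 min.cobounded2 min.coboundedI1) simp
  define k where "k = sqrt (am / 2)"
  define Q where "Q = J * (1 / 2 - bm + 3 * \<epsilon>)"
  have k_pos: "0 < k" and k2: "k * k = am / 2"
    using am_pos by (simp_all add: k_def)
  have kQ: "k * Q = am * (1 / 2 - bm + 3 * \<epsilon>)"
    using am_pos by (simp add: k_def J_def Q_def flip: real_sqrt_mult)
  have Q_le: "Q \<le> J * (1 / 2 - bm) + \<eta>"
    using \<epsilon>(4) \<open>0 < J\<close> by (simp add: Q_def field_simps)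
  \<comment> \<open>\<open>T * C\<close> bounds the total error. Here
    \<open>39 = 11 * 3 + 12 / 2\<close> combines \<open>hu_bound\<close> with \<open>Wdiff\<close>
    and \<open>huu_bound\<close> with \<open>Wx2\<close>; \<open>240 = 6 * 40\<close> comes from
    \<open>\<bar>D\<bar> \<le> T * (6 * K)\<close> and
    \<open>\<bar>R\<bar> \<le> 40\<close>.\<close>
  define C where "C = K * (39 * am + 240 * a1)"
  have "0 < C"
    using K(1) am_pos a1(1) by (simp add: C_def add_pos_pos)
  \<comment> \<open>The first bound keeps the corrector below \<open>\<epsilon> / 2\<close>,
    preserving the behaviour at both ends; the second makes \<open>T * C\<close> smaller than the
    margin.\<close>
  define T0 where "T0 = min (\<epsilon> / (12 * K)) (am * \<epsilon> * m / (2 * C))"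
  have "0 < T0"
    using \<epsilon> K(1) \<open>0 < C\<close> am_pos m(1) by (simp add: T0_def)
  have bound: "c \<le> Q" if "0 < T" "T < T0" and speed: "wave_speed a b T c" for T c
  proof -
    have T_small: "T * (6 * K) \<le> \<epsilon> / 2" "T * C < am * \<epsilon> * m / 2"
      using that(2) K(1) \<open>0 < C\<close> by (simp_all add: T0_def field_simps)
    \<comment> \<open>\<open>h\<close> is the bounded primitive in \<open>\<tau>\<close> of the reaction term minus its average; adding
      \<open>T h(t / T, W)\<close> to \<open>W\<close> cancels the oscillating part of the reaction to leading order.\<close>
    define h where "h \<tau> u = u * (1 - u) * (A \<tau> * u - B \<tau>)" for \<tau> u
    define hu where "hu \<tau> u = (1 - 2 * u) * (A \<tau> * u - B \<tau>) + u * (1 - u) * A \<tau>" for \<tau> u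
    define huu where "huu \<tau> u = 2 * (1 - 2 * u) * A \<tau> - 2 * (A \<tau> * u - B \<tau>)" for \<tau> u
    define W where "W t x = \<epsilon> + front (k * (x - Q * t))" for t x
    define Wt where "Wt t x = k * Q * ((W t x - \<epsilon>) * (1 - (W t x - \<epsilon>)))" for t x
    define Wx where "Wx t x = - (k * ((W t x - \<epsilon>) * (1 - (W t x - \<epsilon>))))" for t x
    define Wxx where "Wxx t x = k * k * ((W t x - \<epsilon>) * (1 - (W t x - \<epsilon>)) * (1 - 2 * (W t x - \<epsilon>)))" for t x
    define w where "w t x = W t x + T * h (t / T) (W t x)" for t x
    define wt where "wt t x = Wt t x
      + W t x * (1 - W t x) * ((a (t / T) - am) * W t x - (a (t / T) * b (t / T) - am * bm))
      + T * (hu (t / T) (W t x) * Wt t x)" for t x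
    define wx where "wx t x = Wx t x + T * (hu (t / T) (W t x) * Wx t x)" for t x
    define wxx where "wxx t x = Wxx t x
      + T * (huu (t / T) (W t x) * (Wx t x * Wx t x) + hu (t / T) (W t x) * Wxx t x)" for t x
    have W: "\<epsilon> < W t x" "W t x < 1 + \<epsilon>" for t x
      by (simp_all add: W_def front_gt_0 front_less_1)
    \<comment> \<open>The range \<open>[0, 2]\<close> contains all values of \<open>W\<close>, so
      the polynomial coefficients of the corrector are bounded uniformly.\<close>
    have lin: "\<bar>A \<tau> * u - B \<tau>\<bar> \<le> 3 * K" if "0 \<le> u" "u \<le> 2" for \<tau> u
    proof -
      have "\<bar>A \<tau> * u\<bar> \<le> K * 2"
        unfolding abs_mult using that K by (intro mult_mono) auto
      then show ?thesis using K(3)[of \<tau>] by linarith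
    qed
    have quad: "\<bar>u * (1 - u)\<bar> \<le> 2" if "0 \<le> u" "u \<le> 2" for u :: real
    proof -
      have "\<bar>u\<bar> * \<bar>1 - u\<bar> \<le> 2 * 1"
        using that by (intro mult_mono) auto
      then show ?thesis by (simp add: abs_mult)
    qed
    have h_bound: "\<bar>h \<tau> u\<bar> \<le> 6 * K" if "0 \<le> u" "u \<le> 2" for \<tau> u
    proof -
      have "\<bar>u * (1 - u)\<bar> * \<bar>A \<tau> * u - B \<tau>\<bar> \<le> 2 * (3 * K)"
        using that by (intro mult_mono lin quad) auto
      then show ?thesis by (simp add: h_def abs_mult)
    qed
    have hu_bound: "\<bar>hu \<tau> u\<bar> \<le> 11 * K" if "0 \<le> u" "u \<le> 2" for \<tau> u
    proof -
      have "\<bar>1 - 2 * u\<bar> * \<bar>A \<tau> * u - B \<tau>\<bar> \<le> 3 * (3 * K)"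
        using that by (intro mult_mono lin) auto
      moreover have "\<bar>u * (1 - u)\<bar> * \<bar>A \<tau>\<bar> \<le> 2 * K"
        using that K by (intro mult_mono quad) auto
      ultimately show ?thesis
        unfolding hu_def by (intro order_trans[OF abs_triangle_ineq]) (simp add: abs_mult)
    qed
    have huu_bound: "\<bar>huu \<tau> u\<bar> \<le> 12 * K" if "0 \<le> u" "u \<le> 2" for \<tau> u
    proof -
      have "\<bar>2 * (1 - 2 * u)\<bar> * \<bar>A \<tau>\<bar> \<le> 6 * K"
        using that K by (intro mult_mono) auto
      then have "\<bar>2 * (1 - 2 * u) * A \<tau>\<bar> \<le> 6 * K"
        by (simp add: abs_mult)
      moreover have "\<bar>2 * (A \<tau> * u - B \<tau>)\<bar> \<le> 6 * K"
        using lin[OF that, of \<tau>] by (simp only: abs_mult) simp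
      ultimately show ?thesis
        unfolding huu_def
        by (intro order_trans[OF abs_triangle_ineq4 order_trans[OF add_mono]]) auto
    qed
    have Th: "\<bar>T * h (t / T) (W t x)\<bar> \<le> T * (6 * K)" for t x
      unfolding abs_mult using \<open>0 < T\<close> W[of t x] \<epsilon>(1,3) by (intro mult_mono h_bound) auto
    have Wt: "((\<lambda>s. W s x) has_real_derivative Wt t x) (at t)" for t x
      unfolding W_def Wt_def by (rule derivative_eq_intros refl)+ (simp add: algebra_simps)
    have Wx: "((\<lambda>y. W t y) has_real_derivative Wx t x) (at x)" for t x
      unfolding W_def Wx_def by (rule derivative_eq_intros refl)+ (simp add: algebra_simps)
    have Wxx: "((\<lambda>y. Wx t y) has_real_derivative Wxx t x) (at x)" for t x
      unfolding Wx_def[of t]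
      by (rule derivative_eq_intros Wx refl)+ (simp add: Wx_def Wxx_def algebra_simps)
    have AB: "((\<lambda>t. A (t / T)) has_real_derivative (a (t / T) - am) / T) (at t)"
      "((\<lambda>t. B (t / T)) has_real_derivative (a (t / T) * b (t / T) - am * bm) / T) (at t)" for t
      using DERIV_chain2[OF A DERIV_cdivide[OF DERIV_ident, of T]]
        DERIV_chain2[OF B DERIV_cdivide[OF DERIV_ident, of T]] by (simp_all add: mult.commute)
    define M where "M = 1 / (\<epsilon> / 4) / k"
    have far: "1 / (\<epsilon> / 4) \<le> k * y" if "M \<le> y" for y
      using mult_left_mono[OF that, of k] k_pos by (simp add: M_def)
    show ?thesis
    proof (rule wave_speed_le_of_strict_supersolution[OF speed \<open>0 < T\<close> a_pos b(2)])
      show "((\<lambda>s. w s x) has_real_derivative wt t x) (at t)" for t x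
      proof -
        have "((\<lambda>s. w s x) has_real_derivative Wt t x
          + T * (W t x * (1 - W t x) * ((a (t / T) - am) / T * W t x - (a (t / T) * b (t / T) - am * bm) / T)
          + hu (t / T) (W t x) * Wt t x)) (at t)"
          unfolding w_def h_def
          by (rule derivative_eq_intros Wt AB refl)+ (simp add: hu_def algebra_simps)
        moreover have "T * (W t x * (1 - W t x) * ((a (t / T) - am) / T * W t x - (a (t / T) * b (t / T) - am * bm) / T)
            + hu (t / T) (W t x) * Wt t x) =
          W t x * (1 - W t x) * ((a (t / T) - am) * W t x - (a (t / T) * b (t / T) - am * bm))
          + T * (hu (t / T) (W t x) * Wt t x)"
          using \<open>0 < T\<close> by (simp add: field_simps)
        ultimately show ?thesis
          by (simp add: wt_def add.assoc)
      qed
      show "((\<lambda>y. w t y) has_real_derivative wx t x) (at x)" for t x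
        unfolding w_def h_def wx_def
        by (rule derivative_eq_intros Wx refl)+ (simp add: hu_def algebra_simps)
      show "((\<lambda>y. wx t y) has_real_derivative wxx t x) (at x)" for t x
        unfolding wx_def hu_def wxx_def
        by (rule derivative_eq_intros Wx Wxx refl)+ (simp add: hu_def huu_def algebra_simps)
      show "continuous_on UNIV (\<lambda>(t, x). w t x)"
        unfolding w_def h_def W_def split_beta
        by (intro continuous_intros continuous_on_compose2[OF cont_AB(1)] continuous_on_compose2[OF cont_AB(2)])
          (use \<open>0 < T\<close> in auto)
      show "\<epsilon> / 4 < w t x" for t x
        using W[of t x] Th[of t x] T_small(1) \<epsilon>(1) unfolding w_def by linarith
      show "1 < w t x" if "x \<le> Q * t - M" for t x
      proof -
        have "1 / (\<epsilon> / 4) \<le> k * (Q * t - x)"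
          using that by (intro far) auto
        then have "k * (x - Q * t) \<le> - (1 / (\<epsilon> / 4))"
          by (simp only: right_diff_distrib)
        then have "1 - \<epsilon> / 4 \<le> front (k * (x - Q * t))"
          using \<epsilon>(1) by (intro front_small(2)) simp_all
        then show ?thesis
          using Th[of t x] T_small(1) \<epsilon>(1) unfolding w_def W_def by linarith
      qed
      show "w t x \<le> 1 - \<epsilon> / 4" if "Q * t + M \<le> x" for t x
      proof -
        have "1 / (\<epsilon> / 4) \<le> k * (x - Q * t)"
          using that by (intro far) auto
        then have "front (k * (x - Q * t)) \<le> \<epsilon> / 4"
          using \<epsilon>(1) by (intro front_small(1)) simp_all
        then show ?thesis
          using Th[of t x] T_small(1) \<epsilon>(1,3) unfolding w_def W_def by linarith
      qed
      show "wxx t x + bistable_nonlinearity a b T t (w t x) < wt t x" for t x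
      proof -
        define \<tau> p u D where "\<tau> = t / T" and "p = W t x - \<epsilon>" and "u = W t x" and "D = T * h \<tau> u"
        have u: "u = \<epsilon> + p" and p: "0 < p" "p < 1" and u02: "0 \<le> u" "u \<le> 2"
          using W[of t x] \<epsilon>(1,3) by (auto simp: p_def u_def)
        have D: "\<bar>D\<bar> \<le> T * (6 * K)" "\<bar>D\<bar> \<le> 1"
          using Th[of t x] T_small(1) \<epsilon>(3) by (simp_all add: D_def \<tau>_def u_def)
        have eq: "Wt t x - Wxx t x = am * (p * (p - bm + 3 * \<epsilon>) * (1 - p))"
        proof -
          have "Wt t x - Wxx t x = p * (1 - p) * (k * Q - k * k * (1 - 2 * p))"
            by (simp add: Wt_def Wxx_def p_def algebra_simps)
          also have "\<dots> = am * (p * (p - bm + 3 * \<epsilon>) * (1 - p))"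
            unfolding k2 kQ by algebra
          finally show ?thesis .
        qed
        have "am * (u * (u - bm) * (1 - u) + \<epsilon> * m / 2) \<le> am * (p * (p - bm + 3 * \<epsilon>) * (1 - p))"
          unfolding u using p bm \<epsilon> am_pos by (intro mult_left_mono cubic_shift_gap) auto
        then have gap: "am * (u * (u - bm) * (1 - u)) + am * \<epsilon> * m / 2 \<le> Wt t x - Wxx t x"
          unfolding eq by (simp add: algebra_simps)
        have Wdiff: "\<bar>Wt t x - Wxx t x\<bar> \<le> am * 3"
        proof -
          have "\<bar>p - bm + 3 * \<epsilon>\<bar> \<le> 3"
            using p bm m(1) \<epsilon> by auto
          then have "\<bar>p\<bar> * \<bar>p - bm + 3 * \<epsilon>\<bar> * \<bar>1 - p\<bar> \<le> 1 * 3 * 1"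
            using p by (intro mult_mono) auto
          then have "am * \<bar>p * (p - bm + 3 * \<epsilon>) * (1 - p)\<bar> \<le> am * 3"
            using am_pos by (simp add: abs_mult)
          then show ?thesis
            unfolding eq abs_mult[of am] using am_pos by simp
        qed
        have Wx2: "\<bar>Wx t x * Wx t x\<bar> \<le> am / 2"
        proof -
          have pp: "p * (1 - p) \<le> 1 * 1" "0 \<le> p * (1 - p)"
            using p by (intro mult_mono mult_nonneg_nonneg; simp)+
          then have "(p * (1 - p)) * (p * (1 - p)) \<le> 1 * 1"
            by (intro mult_mono) auto
          then have "(k * k) * ((p * (1 - p)) * (p * (1 - p))) \<le> (k * k) * 1"
            by (intro mult_left_mono) auto
          moreover have "Wx t x * Wx t x = (k * k) * ((p * (1 - p)) * (p * (1 - p)))"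
            by (simp add: Wx_def p_def)
          ultimately show ?thesis
            unfolding k2 using am_pos pp(2) by simp
        qed
        have corr: "T * (hu \<tau> u * (Wt t x - Wxx t x) - huu \<tau> u * (Wx t x * Wx t x)) \<ge> - (T * (K * (39 * am)))"
        proof -
          have "\<bar>hu \<tau> u * (Wt t x - Wxx t x)\<bar> \<le> 11 * K * (am * 3)"
            unfolding abs_mult using K(1) u02 by (intro mult_mono hu_bound Wdiff) auto
          moreover have "\<bar>huu \<tau> u * (Wx t x * Wx t x)\<bar> \<le> 12 * K * (am / 2)"
            unfolding abs_mult[of "huu \<tau> u"] using K(1) u02 by (intro mult_mono huu_bound Wx2) auto
          ultimately have "- (K * (39 * am)) \<le> hu \<tau> u * (Wt t x - Wxx t x) - huu \<tau> u * (Wx t x * Wx t x)"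
            by (simp add: algebra_simps)
          from mult_left_mono[OF this, of T] show ?thesis
            using \<open>0 < T\<close> by simp
        qed
        have lip: "a \<tau> * (u + D) * (u + D - b \<tau>) * (1 - (u + D)) - a \<tau> * u * (u - b \<tau>) * (1 - u) \<le> T * (K * (240 * a1))"
        proof -
          \<comment> \<open>The divided difference of the cubic
            \<open>z * (z - b \<tau>) * (1 - z)\<close> between \<open>u\<close> and
            \<open>u + D\<close>.\<close>
          define R where "R = - (u * u + u * (u + D) + (u + D) * (u + D)) + (1 + b \<tau>) * (2 * u + D) - b \<tau>"
          have uD: "\<bar>u\<bar> \<le> 2" "\<bar>u + D\<bar> \<le> 3" "\<bar>2 * u + D\<bar> \<le> 5"
            using u02 D(2) by auto
          have "\<bar>u\<bar> * \<bar>u\<bar> \<le> 2 * 2" "\<bar>u\<bar> * \<bar>u + D\<bar> \<le> 2 * 3" "\<bar>u + D\<bar> * \<bar>u + D\<bar> \<le> 3 * 3"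
            using uD by (intro mult_mono; simp)+
          then have "\<bar>u * u\<bar> \<le> 4" "\<bar>u * (u + D)\<bar> \<le> 6" "\<bar>(u + D) * (u + D)\<bar> \<le> 9"
            unfolding abs_mult by simp_all
          moreover have "\<bar>(1 + b \<tau>) * (2 * u + D)\<bar> \<le> 2 * 5"
            unfolding abs_mult using b(1)[of \<tau>] b(2)[of \<tau>] uD(3) by (intro mult_mono) auto
          ultimately have "\<bar>R\<bar> \<le> 40"
            unfolding R_def using b(1)[of \<tau>] b(2)[of \<tau>] by linarith
          have "a \<tau> * (u + D) * (u + D - b \<tau>) * (1 - (u + D)) - a \<tau> * u * (u - b \<tau>) * (1 - u) = a \<tau> * (D * R)"
            unfolding R_def by algebra
          also have "\<dots> \<le> \<bar>a \<tau> * (D * R)\<bar>"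
            by (rule abs_ge_self)
          also have "\<dots> = \<bar>a \<tau>\<bar> * (\<bar>D\<bar> * \<bar>R\<bar>)"
            by (simp add: abs_mult)
          also have "\<dots> \<le> a1 * (T * (6 * K) * 40)"
            using a1 D(1) \<open>\<bar>R\<bar> \<le> 40\<close> K(1) \<open>0 < T\<close> by (intro mult_mono) auto
          finally show ?thesis by (simp add: algebra_simps)
        qed
        \<comment> \<open>The oscillating reaction at \<open>u\<close> has cancelled. What remains
          is the margin of the averaged front, the change of the reaction from \<open>u\<close> to
          \<open>u + D\<close>, and the derivatives of the corrector through
          \<open>W\<close>.\<close>
        have "wt t x - wxx t x - bistable_nonlinearity a b T t (w t x) =
          (Wt t x - Wxx t x - am * (u * (u - bm) * (1 - u)))
          - (a \<tau> * (u + D) * (u + D - b \<tau>) * (1 - (u + D)) - a \<tau> * u * (u - b \<tau>) * (1 - u))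
          + T * (hu \<tau> u * (Wt t x - Wxx t x) - huu \<tau> u * (Wx t x * Wx t x))"
          unfolding wt_def wxx_def bistable_nonlinearity_def w_def D_def \<tau>_def[symmetric] u_def[symmetric]
          by algebra
        moreover have "T * C = T * (K * (39 * am)) + T * (K * (240 * a1))"
          by (simp add: C_def algebra_simps)
        ultimately show ?thesis
          using gap corr lip T_small(2) by linarith
      qed
    qed (use \<epsilon> in auto)
  qed
  have "\<forall>\<^sub>F T in at_right 0. 0 < T \<and> T < T0"
    using \<open>0 < T0\<close> by (intro eventually_conj eventually_at_right_less) (auto simp: eventually_at_right[of 0 "T0"])
  then show ?thesis
    by eventually_elim (use bound Q_le in \<open>force simp: J_def bm_def am_def\<close>)
qed

section \<open>Reflection symmetry and the two limits\<close>

text \<open>The cubic changes sign under \<open>u \<mapsto> 1 - u\<close>,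
  \<open>b \<mapsto> 1 - b\<close>, and the space reflection restores the order of the limits at
  both ends. Upper bounds for the reflected problem thus become lower bounds.\<close>

lemma wave_speed_reflect:
  assumes "wave_speed a b T c"
  shows "wave_speed a (\<lambda>s. 1 - b s) T (- c)"
proof -
  obtain V where wave: "periodic_traveling_wave a b T c V"
    using assms by (auto simp: wave_speed_def)
  obtain vt vx vxx where v:
    "\<And>t x. ((\<lambda>s. V s (x - c * s)) has_real_derivative vt t x) (at t)"
    "\<And>t x. ((\<lambda>y. V t (y - c * t)) has_real_derivative vx t x) (at x)"
    "\<And>t x. ((\<lambda>y. vx t y) has_real_derivative vxx t x) (at x)"
    "continuous_on UNIV (\<lambda>(t, x). vt t x)" "continuous_on UNIV (\<lambda>(t, x). vx t x)"
    "continuous_on UNIV (\<lambda>(t, x). vxx t x)"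
    "\<And>t x. vt t x = vxx t x + bistable_nonlinearity a b T t (V t (x - c * t))"
    using wave unfolding periodic_traveling_wave_def classical_solution_def by blast
  define U where "U t x = 1 - V t (- x)" for t x
  have mirror: "((\<lambda>y. f (- y)) has_real_derivative - D) (at x)"
    if "(f has_real_derivative D) (at (- x))" for f D x
    using DERIV_chain2[OF that DERIV_minus[OF DERIV_ident]] by simp
  have cont_mirror: "continuous_on UNIV (\<lambda>(t, x). f t (- x))"
    if "continuous_on UNIV (\<lambda>(t, x). f t x)" for f :: "real \<Rightarrow> real \<Rightarrow> real"
  proof -
    have "continuous_on UNIV (\<lambda>p. (\<lambda>(t, x). f t x) (fst p, - snd p))"
      by (rule continuous_on_compose2[OF that]) (auto intro!: continuous_intros)
    then show ?thesis by (simp add: split_beta)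
  qed
  have U_eq: "U t (x - - c * t) = 1 - V t (- x - c * t)" for t x
    by (simp add: U_def)
  have "classical_solution (bistable_nonlinearity a (\<lambda>s. 1 - b s) T) (\<lambda>t x. U t (x - - c * t))"
    unfolding classical_solution_def U_eq
  proof (intro exI conjI allI)
    show "((\<lambda>s. 1 - V s (- x - c * s)) has_real_derivative - vt t (- x)) (at t)" for t x
      using DERIV_diff[OF DERIV_const v(1)[of "- x" t]] by simp
    show "((\<lambda>y. 1 - V t (- y - c * t)) has_real_derivative vx t (- x)) (at x)" for t x
      using DERIV_diff[OF DERIV_const mirror[OF v(2)[of t "- x"]]] by simp
    show "((\<lambda>y. vx t (- y)) has_real_derivative - vxx t (- x)) (at x)" for t x
      by (rule mirror[OF v(3)])
    show "- vt t (- x) = - vxx t (- x) +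
        bistable_nonlinearity a (\<lambda>s. 1 - b s) T t (1 - V t (- x - c * t))" for t x
      using v(7)[of t "- x"] by (simp add: bistable_nonlinearity_def algebra_simps)
    show "continuous_on UNIV (\<lambda>(t, x). - vt t (- x))"
      using continuous_on_minus[OF cont_mirror[OF v(4)]] by (simp add: split_beta)
    show "continuous_on UNIV (\<lambda>(t, x). vx t (- x))"
      by (rule cont_mirror[OF v(5)])
    show "continuous_on UNIV (\<lambda>(t, x). - vxx t (- x))"
      using continuous_on_minus[OF cont_mirror[OF v(6)]] by (simp add: split_beta)
  qed
  moreover have "U (t + T) x = U t x" for t x
    using wave by (simp add: U_def periodic_traveling_wave_def)
  moreover have "uniform_limit UNIV (\<lambda>x t. U t x) (\<lambda>t. 1) at_bot"
  proof (rule uniform_limitI)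
    fix e :: real assume "0 < e"
    obtain R where "\<And>t x. R \<le> x \<Longrightarrow> \<bar>V t x\<bar> < e"
      using wave_at_top[OF wave \<open>0 < e\<close>] by blast
    then show "\<forall>\<^sub>F x in at_bot. \<forall>t\<in>UNIV. dist (U t x) 1 < e"
      by (auto simp: eventually_at_bot_linorder U_def dist_real_def intro!: exI[of _ "- R"])
  qed
  moreover have "uniform_limit UNIV (\<lambda>x t. U t x) (\<lambda>t. 0) at_top"
  proof (rule uniform_limitI)
    fix e :: real assume "0 < e"
    obtain R where "\<And>t x. x \<le> - R \<Longrightarrow> \<bar>V t x - 1\<bar> < e"
      using wave_at_bot[OF wave \<open>0 < e\<close>] by blast
    then show "\<forall>\<^sub>F x in at_top. \<forall>t\<in>UNIV. dist (U t x) 0 < e"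
      by (auto simp: eventually_at_top_linorder U_def dist_real_def abs_minus_commute intro!: exI[of _ R])
  qed
  ultimately show ?thesis
    unfolding wave_speed_def periodic_traveling_wave_def by blast
qed

lemma tendsto_of_one_sided_bounds:
  fixes d :: "real \<Rightarrow> real"
  assumes "\<And>\<eta>. 0 < \<eta> \<Longrightarrow> \<forall>\<^sub>F T in F. d T \<le> l + \<eta>"
    and "\<And>\<eta>. 0 < \<eta> \<Longrightarrow> \<forall>\<^sub>F T in F. - d T \<le> - l + \<eta>"
  shows "(d \<longlongrightarrow> l) F"
proof (rule tendstoI)
  fix e :: real assume "0 < e"
  then have "\<forall>\<^sub>F T in F. d T \<le> l + e / 2" "\<forall>\<^sub>F T in F. - d T \<le> - l + e / 2"
    using assms[of "e / 2"] by simp_all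
  then show "\<forall>\<^sub>F T in F. dist (d T) l < e"
    by eventually_elim (use \<open>0 < e\<close> in \<open>auto simp: dist_real_def\<close>)
qed

theorem corollary1p10:
  fixes a b d :: "real \<Rightarrow> real"
  assumes "a C1_differentiable_on UNIV" and "b C1_differentiable_on UNIV"
    and "\<And>s. a (s + 1) = a s" and "\<And>s. b (s + 1) = b s"
    and "\<And>s. 0 < a s" and "\<And>s. 0 < b s" and "\<And>s. b s < 1"
    and "\<And>T. 0 < T \<Longrightarrow> wave_speed a b T (d T)"
  shows "(d \<longlongrightarrow> sqrt (2 * integral {0..1} a) *
             (1 / 2 - integral {0..1} (\<lambda>s. a s * b s) / integral {0..1} a)) (at_right 0)
       \<and> (d \<longlongrightarrow> integral {0..1} (\<lambda>s. sqrt (2 * a s) * (1 / 2 - b s))) at_top"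
proof
  have cont_a: "continuous_on UNIV a" and cont_b: "continuous_on UNIV b"
    using assms(1,2) by (auto intro: C1_differentiable_imp_continuous_on)
  have cont_b': "continuous_on UNIV (\<lambda>s. 1 - b s)"
    by (intro continuous_intros cont_b)
  have speed': "wave_speed a (\<lambda>s. 1 - b s) T (- d T)" if "0 < T" for T
    by (rule wave_speed_reflect[OF assms(8)[OF that]])
  have per': "1 - b (s + 1) = 1 - b s" "0 < 1 - b s" "1 - b s < 1" for s
    using assms(4,6,7) by simp_all
  have int: "f integrable_on {0..1}" if "continuous_on UNIV f" for f :: "real \<Rightarrow> real"
    using that by (intro integrable_continuous_real) (auto intro: continuous_on_subset)
  have int_a_pos: "0 < integral {0..1} a"
    using assms(3,5) cont_a by (intro periodic_pos_integral)
  show "(d \<longlongrightarrow> sqrt (2 * integral {0..1} a) *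
      (1 / 2 - integral {0..1} (\<lambda>s. a s * b s) / integral {0..1} a)) (at_right 0)"
  proof (rule tendsto_of_one_sided_bounds)
    fix \<eta> :: real assume "0 < \<eta>"
    have pos: "\<forall>\<^sub>F T in at_right 0. 0 < (T::real)"
      by (rule eventually_at_right_less)
    show "\<forall>\<^sub>F T in at_right 0. d T \<le> sqrt (2 * integral {0..1} a) *
      (1 / 2 - integral {0..1} (\<lambda>s. a s * b s) / integral {0..1} a) + \<eta>"
      using eventually_wave_speed_le_fast[OF cont_a cont_b assms(3-7) \<open>0 < \<eta>\<close>] pos
      by eventually_elim (use assms(8) in blast)
    \<comment> \<open>The weighted mean of \<open>1 - b\<close> is one minus that of
      \<open>b\<close>, so the candidate limit changes sign under reflection.\<close>
    have split: "integral {0..1} (\<lambda>s. a s * (1 - b s)) = integral {0..1} a - integral {0..1} (\<lambda>s. a s * b s)"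
      unfolding right_diff_distrib mult_1_right
      by (intro integral_diff int continuous_intros cont_a cont_b)
    have "sqrt (2 * integral {0..1} a) *
        (1 / 2 - integral {0..1} (\<lambda>s. a s * (1 - b s)) / integral {0..1} a) =
      - (sqrt (2 * integral {0..1} a) *
        (1 / 2 - integral {0..1} (\<lambda>s. a s * b s) / integral {0..1} a))"
      unfolding split using int_a_pos by (simp add: diff_divide_distrib algebra_simps)
    with eventually_wave_speed_le_fast[OF cont_a cont_b' assms(3) per'(1) assms(5) per'(2,3) \<open>0 < \<eta>\<close>]
    have "\<forall>\<^sub>F T in at_right 0. \<forall>c. wave_speed a (\<lambda>s. 1 - b s) T c \<longrightarrow>
      c \<le> - (sqrt (2 * integral {0..1} a) *
        (1 / 2 - integral {0..1} (\<lambda>s. a s * b s) / integral {0..1} a)) + \<eta>"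
      by simp
    with pos show "\<forall>\<^sub>F T in at_right 0. - d T \<le> - (sqrt (2 * integral {0..1} a) *
        (1 / 2 - integral {0..1} (\<lambda>s. a s * b s) / integral {0..1} a)) + \<eta>"
      by eventually_elim (use speed' in blast)
  qed
  show "(d \<longlongrightarrow> integral {0..1} (\<lambda>s. sqrt (2 * a s) * (1 / 2 - b s))) at_top"
  proof (rule tendsto_of_one_sided_bounds)
    fix \<eta> :: real assume "0 < \<eta>"
    have pos: "\<forall>\<^sub>F T in at_top. 0 < (T::real)"
      by (rule eventually_gt_at_top)
    show "\<forall>\<^sub>F T in at_top. d T \<le> integral {0..1} (\<lambda>s. sqrt (2 * a s) * (1 / 2 - b s)) + \<eta>"
      using eventually_wave_speed_le_slow[OF assms(1) cont_b assms(3-7) \<open>0 < \<eta>\<close>] pos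
      by eventually_elim (use assms(8) in blast)
    have "integral {0..1} (\<lambda>s. sqrt (2 * a s) * (1 / 2 - (1 - b s))) =
      integral {0..1} (\<lambda>s. - (sqrt (2 * a s) * (1 / 2 - b s)))"
      by (simp add: algebra_simps)
    then have "integral {0..1} (\<lambda>s. sqrt (2 * a s) * (1 / 2 - (1 - b s))) =
      - integral {0..1} (\<lambda>s. sqrt (2 * a s) * (1 / 2 - b s))"
      by simp
    with eventually_wave_speed_le_slow[OF assms(1) cont_b' assms(3) per'(1) assms(5) per'(2,3) \<open>0 < \<eta>\<close>]
    have "\<forall>\<^sub>F T in at_top. \<forall>c. wave_speed a (\<lambda>s. 1 - b s) T c \<longrightarrow>
      c \<le> - integral {0..1} (\<lambda>s. sqrt (2 * a s) * (1 / 2 - b s)) + \<eta>"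
      by simp
    with pos show "\<forall>\<^sub>F T in at_top. - d T \<le> - integral {0..1} (\<lambda>s. sqrt (2 * a s) * (1 / 2 - b s)) + \<eta>"
      by eventually_elim (use speed' in blast)
  qed
qed

end
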